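(* Let $h \geq 2$ be an integer and set $n_1 = 2h(2h+1)$, $n_2 = (2h-1)(2h+1)$, $n_3 = 2h(2h+1)+(2h-1)$, $n_4 = (2h-1)2h$. Let $S = \langle n_1,n_2,n_3,n_4\rangle$ be the numerical semigroup generated by these integers. Then $$\mathrm{PF}(S) = \{(2h-1)^3+4h(h-2)+k(2h-1)+1 \mid 0\leq k\leq 2h-3\} \cup \{(2h-1)^3+4h(h-2)+2h(2k+1)+2 \mid 0\leq k\leq 2h-2\},$$ where $k$ ranges over integers.
   Context: $\mathbb{N}$ denotes the non-negative integers. A numerical semigroup is a submonoid $S$ of $(\mathbb{N},+)$ with $\mathbb{N}\setminus S$ finite; $\langle n_1,\ldots,n_e\rangle$ is the submonoid of $\mathbb{N}$ generated by $n_1,\ldots,n_e$. A pseudo-Frobenius number of $S$ is an integer $f\in\mathbb{Z}\setminus S$ such that $f+s\in S$ for all $s\in S\setminus\{0\}$; $\mathrm{PF}(S)$ is the set of all of them. *)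

theory Defs
  imports Complex_Main "HOL.Hull"
begin

definition add_submonoid :: "nat set \<Rightarrow> bool" where
  "add_submonoid S \<longleftrightarrow> 0 \<in> S \<and> (\<forall>x\<in>S. \<forall>y\<in>S. x + y \<in> S)"

definition numerical_semigroup :: "nat set \<Rightarrow> bool" where
  "numerical_semigroup S \<longleftrightarrow> add_submonoid S \<and> finite (UNIV - S)"

definition generated_submonoid :: "nat set \<Rightarrow> nat set" where
  "generated_submonoid A = add_submonoid hull A"

(* Pseudo-Frobenius numbers are integers: PF(\<nat>) = {-1}. *)
definition PF :: "nat set \<Rightarrow> int set" where
  "PF S = {f. f \<notin> int ` S \<and> (\<forall>s\<in>S - {0}. f + int s \<in> int ` S)}"

lemma add_submonoid_generated: "add_submonoid (generated_submonoid A)"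
  unfolding generated_submonoid_def hull_def add_submonoid_def by blast

lemma generators_subset: "A \<subseteq> generated_submonoid A"
  unfolding generated_submonoid_def by (rule hull_subset)

lemma add_submonoid_add: "add_submonoid S \<Longrightarrow> x \<in> S \<Longrightarrow> y \<in> S \<Longrightarrow> x + y \<in> S"
  unfolding add_submonoid_def by blast

lemma add_submonoid_mult:
  assumes "add_submonoid S" "x \<in> S"
  shows "k * x \<in> S"
  using assms by (induction k) (auto simp: add_submonoid_def)

lemma numerical_semigroup_if_consecutive:
  assumes S: "add_submonoid S" and m: "m \<in> S" "Suc m \<in> S"
  shows "numerical_semigroup S"
proof -
  have "n \<in> S" if n: "m * m \<le> n" for n
  proof (cases "m = 0")
    case True
    then show ?thesis using add_submonoid_mult[OF S m(2), of n] by simp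
  next
    case False
    define q r where "q = n div m" and "r = n mod m"
    have "m \<le> q" unfolding q_def using n False
      by (simp add: less_eq_div_iff_mult_less_eq)
    moreover have "r < m" unfolding r_def using False by simp
    ultimately have "n = (q - r) * m + r * Suc m"
      unfolding q_def r_def by (simp add: algebra_simps diff_mult_distrib)
    moreover have "(q - r) * m \<in> S" "r * Suc m \<in> S"
      using add_submonoid_mult[OF S] m by blast+
    ultimately show ?thesis using S unfolding add_submonoid_def by metis
  qed
  then have "UNIV - S \<subseteq> {..<m * m}" by (meson DiffE lessThan_iff not_le subsetI)
  then show ?thesis
    using S finite_subset unfolding numerical_semigroup_def by blast
qed

lemma numerical_semigroup_generated:
  fixes h :: nat
  assumes "h \<ge> 2"
  shows "numerical_semigroup (generated_submonoid
    {2*h*(2*h+1), (2*h-1)*(2*h+1), 2*h*(2*h+1) + (2*h-1), (2*h-1)*(2*h)})"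
    (is "numerical_semigroup ?S")
proof -
  obtain g where h: "h = Suc g" using assms by (cases h) auto
  have S: "add_submonoid ?S" by (rule add_submonoid_generated)
  have gens: "2*h*(2*h+1) \<in> ?S" "(2*h-1)*(2*h+1) \<in> ?S" "(2*h-1)*(2*h) \<in> ?S"
    by (rule subsetD[OF generators_subset], simp)+
  let ?m = "(h-1) * (2*h*(2*h+1)) + h * ((2*h-1)*(2*h))"
  have "?m \<in> ?S"
    by (rule add_submonoid_add[OF S add_submonoid_mult[OF S gens(1)]
          add_submonoid_mult[OF S gens(3)]])
  moreover have "(2*h-1) * ((2*h-1)*(2*h+1)) \<in> ?S"
    by (rule add_submonoid_mult[OF S gens(2)])
  moreover have "(2*h-1) * ((2*h-1)*(2*h+1)) = Suc ?m"
    unfolding h by (simp add: algebra_simps)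
  ultimately show ?thesis
    by (intro numerical_semigroup_if_consecutive[OF S, of ?m]) (simp_all only:)
qed

end

theory Submission
  imports Defs
begin

text \<open>
  Write \<open>b = 2h\<close>. The generators are the four corners of a parallelogram:
  \<open>n4 = b(b-1)\<close>, \<open>n2 = n4 + (b-1)\<close>, \<open>n1 = n4 + 2b\<close> and \<open>n3 = n4 + (b-1) + 2b\<close>.
  A sum of \<open>m\<close> generators therefore has the form \<open>m n4 + u(b-1) + 2b v\<close> with
  \<open>0 \<le> u, v \<le> m\<close>, and every such \<open>(u, v)\<close> occurs, because a lattice point of the square of
  side \<open>m\<close> is a sum of \<open>m\<close> vertices of the unit square.

  Since \<open>b - 1\<close> is odd, it is coprime to \<open>2b\<close>, so every integer is uniquely
  \<open>q n4 + r(b-1) + 2b v\<close> with \<open>0 \<le> r < b\<close> and \<open>0 \<le> v < b - 1\<close>. Reducing a sum of generators to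
  these coordinates can only lower \<open>u\<close> and \<open>v\<close> and raise \<open>m\<close>, since \<open>b(b-1) = n4\<close> and
  \<open>2b(b-1) = 2 n4\<close>; hence an integer lies in \<open>S\<close> iff its coordinates satisfy
  \<open>max r v \<le> q\<close> (lemma \<open>coord_mem_iff\<close>).

  A pseudo-Frobenius number misses this inequality but satisfies it after any generator is added.
  The case of \<open>n4\<close> forces \<open>q = max r v - 1\<close>. Adding \<open>n2\<close> raises \<open>q\<close> and \<open>r\<close> by one, which succeeds
  only if \<open>v > r\<close> or \<open>r\<close> wraps around; adding \<open>n1\<close> likewise needs \<open>r > v\<close> or that \<open>v\<close> wraps
  around. So either \<open>v = b - 2 > r\<close>, which gives the first family (with \<open>k = r\<close>), or
  \<open>r = b - 1\<close>, which gives the second (with \<open>k = v\<close>).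
\<close>

section \<open>Pseudo-Frobenius numbers of a generated monoid\<close>

lemma generated_submonoid_minimal:
  assumes "A \<subseteq> T" "add_submonoid T"
  shows "generated_submonoid A \<subseteq> T"
  unfolding generated_submonoid_def using assms by (rule hull_minimal)

text \<open>
  For fixed \<open>f\<close> that satisfies the condition on generators, the \<open>s \<in> S\<close> that are zero or
  satisfy \<open>f + s \<in> S\<close> form a monoid; it contains \<open>A\<close>, hence is all of \<open>S\<close>.
\<close>
lemma PF_generated_submonoid_iff:
  "f \<in> PF (generated_submonoid A) \<longleftrightarrow>
     f \<notin> int ` generated_submonoid A \<and>
     (\<forall>a\<in>A - {0}. f + int a \<in> int ` generated_submonoid A)"
    (is "_ \<longleftrightarrow> _ \<and> ?gens")
proof -
  let ?S = "generated_submonoid A"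
  have S: "add_submonoid ?S" by (rule add_submonoid_generated)
  have "\<forall>s\<in>?S - {0}. f + int s \<in> int ` ?S" if gens: ?gens
  proof -
    define T where "T = {s \<in> ?S. s = 0 \<or> f + int s \<in> int ` ?S}"
    have shift: "f + int (x + y) \<in> int ` ?S" if "f + int x \<in> int ` ?S" "y \<in> ?S" for x y
    proof -
      from that(1) obtain z where "z \<in> ?S" "f + int x = int z" by auto
      then have "f + int (x + y) = int (z + y)" "z + y \<in> ?S"
        using add_submonoid_add[OF S] that(2) by auto
      then show ?thesis by (simp only: image_eqI)
    qed
    have "x + y \<in> T" if "x \<in> T" "y \<in> T" for x y
    proof -
      have "x + y \<in> ?S" using that add_submonoid_add[OF S] unfolding T_def by auto
      moreover have "x + y = 0 \<or> f + int (x + y) \<in> int ` ?S"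
        using that shift[of x y] shift[of y x] unfolding T_def by (auto simp: add.commute)
      ultimately show ?thesis unfolding T_def by blast
    qed
    then have "add_submonoid T"
      using S unfolding add_submonoid_def T_def by auto
    moreover have "A \<subseteq> T" using gens generators_subset[of A] unfolding T_def by auto
    ultimately have "?S \<subseteq> T" by (rule generated_submonoid_minimal[rotated])
    then show ?thesis unfolding T_def by auto
  qed
  then show ?thesis using generators_subset[of A] unfolding PF_def by blast
qed

section \<open>Coordinates adapted to the generators\<close>

text \<open>This is \<open>q n4 + r (2h - 1) + v (4h)\<close>. In a sum of generators, \<open>q\<close> is the number of
  summands; \<open>2h - 1\<close> and \<open>4h\<close> are the sides of the parallelogram of generators.\<close>
definition coord :: "int \<Rightarrow> int \<Rightarrow> int \<Rightarrow> int \<Rightarrow> int" where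
  "coord h q r v = (2*h - 1) * (2*h*q + r) + 2*(2*h)*v"

lemma coord_carry_r: "coord h q (r + 2*h) v = coord h (q + 1) r v"
  unfolding coord_def by (simp add: algebra_simps)

lemma coord_carry_v: "coord h q r (v + (2*h - 1)) = coord h (q + 2) r v"
  unfolding coord_def by (simp add: algebra_simps)

lemma coord_add:
  "coord h q r v + coord h q' r' v' = coord h (q + q') (r + r') (v + v')"
  unfolding coord_def by (simp add: algebra_simps)

lemma coord_mult: "k * coord h q r v = coord h (k*q) (k*r) (k*v)"
  unfolding coord_def by (simp add: algebra_simps)

text \<open>Reducing to the fundamental box carries multiples of \<open>2h\<close> and \<open>2h - 1\<close> into the first
  coordinate.\<close>
lemma coord_normalize:
  "coord h q r v =
     coord h (q + r div (2*h) + 2 * (v div (2*h - 1))) (r mod (2*h)) (v mod (2*h - 1))"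
proof -
  have "coord h q r v = coord h q (2*h * (r div (2*h)) + r mod (2*h))
      ((2*h - 1) * (v div (2*h - 1)) + v mod (2*h - 1))" by simp
  also have "\<dots> = coord h (q + r div (2*h) + 2 * (v div (2*h - 1)))
      (r mod (2*h)) (v mod (2*h - 1))"
    unfolding coord_def by (simp only: algebra_simps)
  finally show ?thesis .
qed

lemma coord_inject:
  assumes h: "h \<ge> 1"
    and r: "0 \<le> r" "r < 2*h" "0 \<le> r'" "r' < 2*h"
    and v: "0 \<le> v" "v < 2*h - 1" "0 \<le> v'" "v' < 2*h - 1"
    and eq: "coord h q r v = coord h q' r' v'"
  shows "q = q' \<and> r = r' \<and> v = v'"
proof -
  define a where "a = 2*h - 1"
  have "a * (2*h*q + r - (2*h*q' + r')) = 2*(2*h) * (v' - v)"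
    using eq unfolding coord_def a_def by (simp add: algebra_simps)
  then have "a dvd 2*(2*h) * (v' - v)" by (metis dvd_triv_left)
  (* modulo a = 2h - 1, the factor 4h is 2, and its inverse is h *)
  moreover have "v' - v = h * (2*(2*h) * (v' - v)) - a * ((2*h + 1) * (v' - v))"
    unfolding a_def by (simp add: algebra_simps)
  ultimately have "a dvd v' - v" by (metis dvd_diff dvd_mult dvd_triv_left)
  then have "v' mod a = v mod a" by (simp add: mod_eq_dvd_iff)
  then have vv: "v = v'" using v unfolding a_def by simp
  then have A: "2*h*q + r = 2*h*q' + r'" using eq h unfolding coord_def by simp
  have "(2*h*q + r) mod (2*h) = r" "(2*h*q' + r') mod (2*h) = r'" using r by auto
  with A have "r = r'" by simp
  with A vv h show ?thesis by simp
qed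

text \<open>As \<open>h\<close> is inverse to \<open>2\<close> modulo \<open>2h - 1\<close>, the choice \<open>v = h f\<close> makes \<open>f - 4h v\<close>
  divisible by \<open>2h - 1\<close>.\<close>
lemma coord_exhaust:
  assumes h: "h \<ge> 1"
  obtains q r v where "f = coord h q r v"
    "0 \<le> r" "r < 2*h" "0 \<le> v" "v < 2*h - 1"
proof -
  have "f = coord h 0 (- (2*h + 1) * f) (h * f)"
    unfolding coord_def by (simp add: algebra_simps)
  also note coord_normalize
  finally show thesis
    by (rule that) (use h in auto)
qed

section \<open>Membership in the semigroup\<close>

definition S_gens :: "nat \<Rightarrow> nat set" where
  "S_gens h = {2*h*(2*h+1), (2*h-1)*(2*h+1), 2*h*(2*h+1) + (2*h-1), (2*h-1)*(2*h)}"

lemma int_generators: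
  assumes "h \<ge> 1"
  shows "int ((2*h-1)*(2*h)) = coord (int h) 1 0 0"
    and "int ((2*h-1)*(2*h+1)) = coord (int h) 1 1 0"
    and "int (2*h*(2*h+1)) = coord (int h) 1 0 1"
    and "int (2*h*(2*h+1) + (2*h-1)) = coord (int h) 1 1 1"
proof -
  obtain g where "h = Suc g" using assms by (cases h) auto
  then show "int ((2*h-1)*(2*h)) = coord (int h) 1 0 0"
    "int ((2*h-1)*(2*h+1)) = coord (int h) 1 1 0"
    "int (2*h*(2*h+1)) = coord (int h) 1 0 1"
    "int (2*h*(2*h+1) + (2*h-1)) = coord (int h) 1 1 1"
    unfolding coord_def by (simp_all add: algebra_simps)
qed

text \<open>A point \<open>(u, v)\<close> with \<open>u \<le> v \<le> m\<close> is \<open>u (1,1) + (v - u) (0,1) + (m - v) (0,0)\<close>, and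
  symmetrically for \<open>v \<le> u\<close>; conversely, the square of side \<open>m\<close> plus that of side \<open>m'\<close> lies
  in the square of side \<open>m + m'\<close>.\<close>
lemma int_generated_submonoid_eq:
  assumes h: "h \<ge> 1"
  shows "int ` generated_submonoid (S_gens h) =
    {coord (int h) m u v | m u v. 0 \<le> u \<and> u \<le> m \<and> 0 \<le> v \<and> v \<le> m}" (is "int ` ?S = ?R")
proof
  let ?c = "coord (int h)"
  define T where "T = {n. int n \<in> ?R}"
  have "S_gens h \<subseteq> T"
  proof -
    have "?c 1 u v \<in> ?R" if "0 \<le> u" "u \<le> 1" "0 \<le> v" "v \<le> 1" for u v
      using that by blast
    then show ?thesis
      unfolding S_gens_def T_def insert_subset mem_Collect_eq int_generators[OF h] by simp
  qed
  moreover have "x + y \<in> T" if "x \<in> T" "y \<in> T" for x y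
  proof -
    from that obtain m u v m' u' v' where *: "int x = ?c m u v" "int y = ?c m' u' v'"
      "0 \<le> u" "u \<le> m" "0 \<le> v" "v \<le> m" "0 \<le> u'" "u' \<le> m'" "0 \<le> v'" "v' \<le> m'"
      unfolding T_def by blast
    have "int (x + y) = ?c (m + m') (u + u') (v + v')" using * by (simp add: coord_add)
    moreover have "0 \<le> u + u'" "u + u' \<le> m + m'" "0 \<le> v + v'" "v + v' \<le> m + m'"
      using * by auto
    ultimately show ?thesis unfolding T_def by blast
  qed
  moreover have "0 \<in> T"
  proof -
    have "int 0 = ?c 0 0 0" unfolding coord_def by simp
    then show ?thesis unfolding T_def by blast
  qed
  ultimately have "?S \<subseteq> T"
    by (intro generated_submonoid_minimal) (auto simp: add_submonoid_def)
  then show "int ` ?S \<subseteq> ?R" unfolding T_def by blast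
next
  let ?c = "coord (int h)"
  have S: "add_submonoid ?S" by (rule add_submonoid_generated)
  have add: "x + y \<in> int ` ?S" if "x \<in> int ` ?S" "y \<in> int ` ?S" for x y
  proof -
    from that obtain i j where "x = int i" "y = int j" "i \<in> ?S" "j \<in> ?S" by auto
    then have "x + y = int (i + j)" "i + j \<in> ?S" using add_submonoid_add[OF S] by auto
    then show ?thesis by (simp only: image_eqI)
  qed
  have mult: "k * x \<in> int ` ?S" if "0 \<le> k" "x \<in> int ` ?S" for k x
  proof -
    from that obtain i where "x = int i" "i \<in> ?S" by auto
    then have "k * x = int (nat k * i)" "nat k * i \<in> ?S"
      using add_submonoid_mult[OF S] that(1) by auto
    then show ?thesis by (simp only: image_eqI)
  qed
  have "int ` S_gens h \<subseteq> int ` ?S" using generators_subset by blast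
  then have gens: "?c 1 0 0 \<in> int ` ?S" "?c 1 1 0 \<in> int ` ?S"
    "?c 1 0 1 \<in> int ` ?S" "?c 1 1 1 \<in> int ` ?S"
    unfolding S_gens_def image_insert int_generators[OF h] by auto
  show "?R \<subseteq> int ` ?S"
  proof
    fix x assume "x \<in> ?R"
    then obtain m u v where x: "x = ?c m u v" and b: "0 \<le> u" "u \<le> m" "0 \<le> v" "v \<le> m"
      by blast
    show "x \<in> int ` ?S"
    proof (cases "u \<le> v")
      case True
      have "x = u * ?c 1 1 1 + (v - u) * ?c 1 0 1 + (m - v) * ?c 1 0 0"
        unfolding x coord_mult coord_add by simp
      then show ?thesis using add mult gens b True by simp
    next
      case False
      have "x = v * ?c 1 1 1 + (u - v) * ?c 1 1 0 + (m - u) * ?c 1 0 0"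
        unfolding x coord_mult coord_add by simp
      then show ?thesis using add mult gens b False by simp
    qed
  qed
qed

text \<open>Normalizing a sum of generators never increases \<open>u\<close> or \<open>v\<close> nor decreases \<open>m\<close>, so the
  inequalities \<open>u, v \<le> m\<close> survive.\<close>
lemma coord_mem_iff:
  assumes h: "h \<ge> 1" and r: "0 \<le> r" "r < 2 * int h" and v: "0 \<le> v" "v < 2 * int h - 1"
  shows "coord (int h) q r v \<in> int ` generated_submonoid (S_gens h) \<longleftrightarrow> r \<le> q \<and> v \<le> q"
proof
  let ?b = "2 * int h" and ?a = "2 * int h - 1"
  assume "coord (int h) q r v \<in> int ` generated_submonoid (S_gens h)"
  then obtain m u w where eq: "coord (int h) q r v = coord (int h) m u w"
    and b: "0 \<le> u" "u \<le> m" "0 \<le> w" "w \<le> m"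
    unfolding int_generated_submonoid_eq[OF h] by blast
  have "q = m + u div ?b + 2 * (w div ?a) \<and> r = u mod ?b \<and> v = w mod ?a"
    using eq h r v unfolding coord_normalize[of "int h" m u w]
    by (intro coord_inject[of "int h"]) auto
  moreover have "0 \<le> u div ?b" "0 \<le> w div ?a" "u mod ?b \<le> u" "w mod ?a \<le> w"
    using h b by (auto intro!: pos_imp_zdiv_nonneg_iff[THEN iffD2] zmod_le_nonneg_dividend)
  ultimately show "r \<le> q \<and> v \<le> q" using b by linarith
next
  assume "r \<le> q \<and> v \<le> q"
  then show "coord (int h) q r v \<in> int ` generated_submonoid (S_gens h)"
    unfolding int_generated_submonoid_eq[OF h] using r v by blast
qed

section \<open>The pseudo-Frobenius numbers\<close>

text \<open>Adding a generator adds one to \<open>q\<close> and to a subset of \<open>{r, v}\<close>; a coordinate that leaves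
  the box wraps around to zero and feeds \<open>q\<close> a further \<open>1\<close> (for \<open>r\<close>) or \<open>2\<close> (for \<open>v\<close>).\<close>
lemma coord_PF_iff:
  assumes h: "h \<ge> 2" and r: "0 \<le> r" "r < 2 * int h" and v: "0 \<le> v" "v < 2 * int h - 1"
  shows "coord (int h) q r v \<in> PF (generated_submonoid (S_gens h)) \<longleftrightarrow>
    v = 2 * int h - 2 \<and> r \<le> 2 * int h - 3 \<and> q = 2 * int h - 3 \<or>
    r = 2 * int h - 1 \<and> q = 2 * int h - 2"
proof -
  let ?c = "coord (int h)" and ?b = "2 * int h"
  let ?S = "int ` generated_submonoid (S_gens h)"
  have h1: "h \<ge> 1" using h by simp
  note mem = coord_mem_iff[OF h1]
  have wrap_r: "?c (q + 1) (r + 1) v' = ?c (q + 2) 0 v'" if "r + 1 = ?b" for v'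
    using coord_carry_r[of "int h" "q + 1" 0 v'] that by (simp add: add.assoc)
  have wrap_v: "?c q' r' (v + 1) = ?c (q' + 2) r' 0" if "v + 1 = ?b - 1" for q' r'
    unfolding that using coord_carry_v[of "int h" q' r' 0] by simp
  have n4: "?c (q + 1) r v \<in> ?S \<longleftrightarrow> r \<le> q + 1 \<and> v \<le> q + 1"
    by (rule mem) (use r v in auto)
  have n2: "?c (q + 1) (r + 1) v \<in> ?S \<longleftrightarrow>
      (if r + 1 = ?b then 0 \<le> q + 2 \<and> v \<le> q + 2 else r \<le> q \<and> v \<le> q + 1)"
    using r v h wrap_r[of v] mem[of 0 v "q + 2"] mem[of "r + 1" v "q + 1"]
    by (simp add: add.assoc)
  have n1: "?c (q + 1) r (v + 1) \<in> ?S \<longleftrightarrow>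
      (if v + 1 = ?b - 1 then r \<le> q + 3 \<and> 0 \<le> q + 3 else r \<le> q + 1 \<and> v \<le> q)"
    using r v h wrap_v[of "q + 1" r] mem[of r 0 "q + 3"] mem[of r "v + 1" "q + 1"]
    by (simp add: add.assoc)
  have n3: "?c (q + 1) (r + 1) (v + 1) \<in> ?S \<longleftrightarrow>
      (if r + 1 = ?b then if v + 1 = ?b - 1 then 0 \<le> q + 4 else 0 \<le> q + 2 \<and> v \<le> q + 1
       else if v + 1 = ?b - 1 then r \<le> q + 2 \<and> 0 \<le> q + 3 else r \<le> q \<and> v \<le> q)"
    using r v h wrap_r[of "v + 1"] wrap_v[of "q + 1" "r + 1"] wrap_v[of "q + 2" 0]
      mem[of 0 0 "q + 4"] mem[of 0 "v + 1" "q + 2"]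
      mem[of "r + 1" 0 "q + 3"] mem[of "r + 1" "v + 1" "q + 1"]
    by (simp add: ac_simps)
  have "S_gens h - {0} = S_gens h" using h unfolding S_gens_def by auto
  then have "?c q r v \<in> PF (generated_submonoid (S_gens h)) \<longleftrightarrow>
      ?c q r v \<notin> ?S \<and> (\<forall>a\<in>S_gens h. ?c q r v + int a \<in> ?S)"
    by (simp add: PF_generated_submonoid_iff)
  also have "\<dots> \<longleftrightarrow> ?c q r v \<notin> ?S \<and> ?c (q + 1) r v \<in> ?S \<and> ?c (q + 1) (r + 1) v \<in> ?S \<and>
      ?c (q + 1) r (v + 1) \<in> ?S \<and> ?c (q + 1) (r + 1) (v + 1) \<in> ?S"
    unfolding S_gens_def[of h] ball_simps int_generators[OF h1] coord_add
    unfolding S_gens_def[of h, symmetric] by auto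
  also have "\<dots> \<longleftrightarrow> v = ?b - 2 \<and> r \<le> ?b - 3 \<and> q = ?b - 3 \<or> r = ?b - 1 \<and> q = ?b - 2"
    unfolding mem[OF r v] n1 n2 n3 n4 using r v h by (auto split: if_splits)
  finally show ?thesis .
qed

theorem theorem3p8:
  fixes h n1 n2 n3 n4 :: nat and S :: "nat set"
  assumes "h \<ge> 2"
    and "n1 = 2*h*(2*h + 1)"
    and "n2 = (2*h - 1)*(2*h + 1)"
    and "n3 = 2*h*(2*h + 1) + (2*h - 1)"
    and "n4 = (2*h - 1)*(2*h)"
    and "S = generated_submonoid {n1, n2, n3, n4}"
  shows "PF S =
      {(2*int h - 1)^3 + 4*int h*(int h - 2) + k*(2*int h - 1) + 1 | k :: int.
         0 \<le> k \<and> k \<le> 2*int h - 3}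
    \<union> {(2*int h - 1)^3 + 4*int h*(int h - 2) + 2*int h*(2*k + 1) + 2 | k :: int.
         0 \<le> k \<and> k \<le> 2*int h - 2}"
proof -
  let ?c = "coord (int h)" and ?b = "2 * int h"
  have S: "S = generated_submonoid (S_gens h)" using assms unfolding S_gens_def by simp
  have fam1: "(?b - 1)^3 + 4*int h*(int h - 2) + k*(?b - 1) + 1 = ?c (?b - 3) k (?b - 2)" for k
    unfolding coord_def by (simp add: algebra_simps power3_eq_cube)
  have fam2: "(?b - 1)^3 + 4*int h*(int h - 2) + ?b*(2*k + 1) + 2 = ?c (?b - 2) (?b - 1) k" for k
    unfolding coord_def by (simp add: algebra_simps power3_eq_cube)
  have "f \<in> PF S \<longleftrightarrow>
      (\<exists>k. f = ?c (?b - 3) k (?b - 2) \<and> 0 \<le> k \<and> k \<le> ?b - 3) \<or>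
      (\<exists>k. f = ?c (?b - 2) (?b - 1) k \<and> 0 \<le> k \<and> k \<le> ?b - 2)" (is "_ \<longleftrightarrow> ?R f") for f
  proof
    assume f: "f \<in> PF S"
    obtain q r v where *: "f = ?c q r v" "0 \<le> r" "r < ?b" "0 \<le> v" "v < ?b - 1"
      using coord_exhaust[of "int h" f] assms(1) by auto
    then have "v = ?b - 2 \<and> r \<le> ?b - 3 \<and> q = ?b - 3 \<or> r = ?b - 1 \<and> q = ?b - 2"
      using f coord_PF_iff[OF assms(1)] unfolding S by blast
    moreover have "v \<le> ?b - 2" using *(5) by simp
    ultimately show "?R f" using * by blast
  next
    assume "?R f"
    then show "f \<in> PF S"
      using coord_PF_iff[OF assms(1)] assms(1) unfolding S by auto
  qed
  then show ?thesis unfolding fam1 fam2 by blast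
qed

end
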